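(* Let $G$ be a finitely generated virtually free group and $K$ a finitely generated subgroup of $G$. Then the pair $(G,K)$ is context-free.
   Context: A group is virtually free if it contains a free subgroup of finite index. A *semigroup presentation* of a finitely generated group $G$ is a (not necessarily injective) map $\psi:\Sigma\to G$ from a finite alphabet $\Sigma$ such that its extension to a monoid homomorphism $\psi:\Sigma^*\to G$ is surjective. For a subgroup $K\le G$, $L(G,K,\psi)=\{w\in\Sigma^*:\psi(w)\in K\}$. The pair $(G,K)$ is *context-free* if $L(G,K,\psi)$ is a context-free language for some (equivalently, every) semigroup presentation $\psi$ of $G$. *)

theory Defs
  imports "HOL-Algebra.Generated_Groups"
begin

section \<open>Context-free languages\<close>

text \<open>Symbols are \<^term>\<open>Inl A\<close> for a nonterminal \<^term>\<open>A\<close> and \<^term>\<open>Inr a\<close> for a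
  terminal \<^term>\<open>a\<close>; a grammar is a set of productions together with a start symbol.\<close>

type_synonym ('n, 't) production = "'n \<times> ('n + 't) list"

inductive derives_step ::
  "('n, 't) production set \<Rightarrow> ('n + 't) list \<Rightarrow> ('n + 't) list \<Rightarrow> bool" for P where
  "(A, \<alpha>) \<in> P \<Longrightarrow> derives_step P (u @ [Inl A] @ v) (u @ \<alpha> @ v)"

definition grammar_language :: "('n, 't) production set \<Rightarrow> 'n \<Rightarrow> 't list set" where
  "grammar_language P S = {w. (derives_step P)\<^sup>*\<^sup>* [Inl S] (map Inr w)}"

text \<open>A finite set of productions involves only finitely many nonterminals, so taking
  them from \<^typ>\<open>nat\<close> is no restriction.\<close>

definition context_free_language :: "'t set \<Rightarrow> 't list set \<Rightarrow> bool" where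
  "context_free_language \<Sigma> L \<longleftrightarrow>
     finite \<Sigma> \<and>
     (\<exists>(P :: (nat, 't) production set) S.
        finite P \<and> (\<forall>(A, \<alpha>) \<in> P. \<forall>a. Inr a \<in> set \<alpha> \<longrightarrow> a \<in> \<Sigma>) \<and>
        L = grammar_language P S)"


section \<open>Words in groups\<close>

text \<open>The extension of a map on letters to a monoid homomorphism on words.\<close>

definition word_map :: "('a, 'b) monoid_scheme \<Rightarrow> ('s \<Rightarrow> 'a) \<Rightarrow> 's list \<Rightarrow> 'a" where
  "word_map G \<psi> w = foldr (\<lambda>s g. \<psi> s \<otimes>\<^bsub>G\<^esub> g) w \<one>\<^bsub>G\<^esub>"

definition finitely_generated_group :: "('a, 'b) monoid_scheme \<Rightarrow> bool" where
  "finitely_generated_group G \<longleftrightarrow>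
     group G \<and> (\<exists>S. finite S \<and> S \<subseteq> carrier G \<and> generate G S = carrier G)"


section \<open>Free and virtually free groups\<close>

text \<open>The letter \<open>(x, True)\<close> stands for the generator \<open>x\<close> and \<open>(x, False)\<close> for its
  formal inverse. A group is free on \<open>X\<close> if every element is the value of exactly one
  reduced word over \<open>X\<close> and the formal inverses of its elements.\<close>

definition reduced_word :: "('a \<times> bool) list \<Rightarrow> bool" where
  "reduced_word w \<longleftrightarrow> successively (\<lambda>(x, b) (y, c). \<not> (x = y \<and> b \<noteq> c)) w"

definition signed_letter :: "('a, 'b) monoid_scheme \<Rightarrow> 'a \<times> bool \<Rightarrow> 'a" where
  "signed_letter G = (\<lambda>(x, b). if b then x else inv\<^bsub>G\<^esub> x)"

definition free_basis :: "('a, 'b) monoid_scheme \<Rightarrow> 'a set \<Rightarrow> bool" where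
  "free_basis G X \<longleftrightarrow>
     X \<subseteq> carrier G \<and>
     bij_betw (word_map G (signed_letter G)) {w \<in> lists (X \<times> UNIV). reduced_word w} (carrier G)"

definition free_group :: "('a, 'b) monoid_scheme \<Rightarrow> bool" where
  "free_group G \<longleftrightarrow> group G \<and> (\<exists>X. free_basis G X)"

definition virtually_free_group :: "('a, 'b) monoid_scheme \<Rightarrow> bool" where
  "virtually_free_group G \<longleftrightarrow>
     group G \<and>
     (\<exists>F. subgroup F G \<and> finite (rcosets\<^bsub>G\<^esub> F) \<and> free_group (G\<lparr>carrier := F\<rparr>))"


section \<open>Context-free pairs\<close>

definition semigroup_presentation ::
  "('a, 'b) monoid_scheme \<Rightarrow> 's set \<Rightarrow> ('s \<Rightarrow> 'a) \<Rightarrow> bool" where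
  "semigroup_presentation G \<Sigma> \<psi> \<longleftrightarrow>
     finite \<Sigma> \<and> \<psi> \<in> \<Sigma> \<rightarrow> carrier G \<and> word_map G \<psi> ` lists \<Sigma> = carrier G"

definition pair_language ::
  "('a, 'b) monoid_scheme \<Rightarrow> 'a set \<Rightarrow> 's set \<Rightarrow> ('s \<Rightarrow> 'a) \<Rightarrow> 's list set" where
  "pair_language G K \<Sigma> \<psi> = {w \<in> lists \<Sigma>. word_map G \<psi> w \<in> K}"

text \<open>Every finite alphabet can be renamed to a finite subset of \<^typ>\<open>nat\<close>, so the
  existential quantifier ranges over all semigroup presentations up to renaming of letters.\<close>

definition context_free_pair :: "('a, 'b) monoid_scheme \<Rightarrow> 'a set \<Rightarrow> bool" where
  "context_free_pair G K \<longleftrightarrow>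
     (\<exists>(\<Sigma> :: nat set) \<psi>. semigroup_presentation G \<Sigma> \<psi> \<and>
        context_free_language \<Sigma> (pair_language G K \<Sigma> \<psi>))"

end

theory Submission
  imports Defs
begin

text \<open>Let \<open>F\<close> be a free subgroup of finite index, \<open>T\<close> a transversal of its right cosets, and \<open>Y\<close> a
  finite set that generates \<open>K\<close> as a monoid. A word \<open>w\<close> has its value in \<open>K\<close> iff some
  word \<open>w y\<^sub>1 \<dots> y\<^sub>n\<close> with letters \<open>y\<^sub>i\<close> in \<open>Y\<close> has value \<open>1\<close>. Reading this word, one moves from
  \<open>t\<close> to the representative of \<open>t \<otimes> z\<close> and outputs a word for the remaining factor in \<open>F\<close>, letter by
  letter, so that only finitely many elements of the group occur as states. In total the output
  has value \<open>1\<close>, hence cancels to the empty word. Cancelling adjacent outputs \<open>a\<close>, \<open>a\<^sup>-\<^sup>1\<close>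
  glues two paths \<open>h \<rightarrow> a \<otimes> k\<close> and \<open>k \<rightarrow> a\<^sup>-\<^sup>1 \<otimes> k'\<close> to a path \<open>h \<rightarrow> k'\<close>, which is a production of
  a grammar with one nonterminal for each quotient \<open>h\<^sup>-\<^sup>1 \<otimes> h'\<close> of states and each pair of
  stages (reading \<open>w\<close>, or guessing the \<open>y\<^sub>i\<close>).\<close>

section \<open>Context-free languages from finite families of languages\<close>

fun form_language :: "('n \<Rightarrow> 't list set) \<Rightarrow> ('n + 't) list \<Rightarrow> 't list set" where
  "form_language I [] = {[]}"
| "form_language I (Inl n # \<alpha>) = {u @ v | u v. u \<in> I n \<and> v \<in> form_language I \<alpha>}"
| "form_language I (Inr a # \<alpha>) = (#) a ` form_language I \<alpha>"

lemma form_language_append: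
  "form_language I (\<alpha> @ \<beta>) = {u @ v | u v. u \<in> form_language I \<alpha> \<and> v \<in> form_language I \<beta>}"
proof (induction \<alpha>)
  case Nil
  then show ?case by simp
next
  case (Cons x \<alpha>)
  show ?case
  proof (cases x)
    case (Inl n)
    show ?thesis
      unfolding Inl append_Cons form_language.simps Cons
      by (auto; metis append.assoc)
  next
    case (Inr a)
    show ?thesis
      unfolding Inr append_Cons form_language.simps Cons
      by (auto simp: image_iff; metis append_Cons)
  qed
qed

lemma form_language_map_Inr [simp]: "form_language I (map Inr w) = {w}"
  by (induction w) auto

lemma derives_step_form_language:
  assumes "derives_step P \<alpha> \<beta>" and "\<And>n \<gamma>. (n, \<gamma>) \<in> P \<Longrightarrow> form_language I \<gamma> \<subseteq> I n"
  shows "form_language I \<beta> \<subseteq> form_language I \<alpha>"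
  using assms(1)
proof cases
  case (1 n \<gamma> u v)
  then have "form_language I \<gamma> \<subseteq> I n"
    by (intro assms(2))
  with 1 show ?thesis
    by (simp only: form_language_append form_language.simps) blast
qed

text \<open>Under an interpretation closed under all productions, the language of a form can only
  shrink along a derivation, and a terminal word denotes just itself.\<close>

lemma grammar_language_subset:
  assumes "\<And>n \<gamma>. (n, \<gamma>) \<in> P \<Longrightarrow> form_language I \<gamma> \<subseteq> I n"
  shows "grammar_language P S \<subseteq> I S"
proof
  fix w assume "w \<in> grammar_language P S"
  then have "(derives_step P)\<^sup>*\<^sup>* [Inl S] (map Inr w)"
    by (simp add: grammar_language_def)
  then have "form_language I (map Inr w) \<subseteq> form_language I [Inl S]"
    by (induction rule: rtranclp_induct) (use derives_step_form_language assms in blast)+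
  then show "w \<in> I S"
    by simp
qed

section \<open>Composition of derivations\<close>

lemma derives_step_context:
  assumes "derives_step P \<alpha> \<beta>"
  shows "derives_step P (u @ \<alpha> @ v) (u @ \<beta> @ v)"
  using assms
proof cases
  case (1 A \<gamma> x y)
  then show ?thesis
    using derives_step.intros[of A \<gamma> P "u @ x" "y @ v"] by simp
qed

lemma derives_context:
  assumes "(derives_step P)\<^sup>*\<^sup>* \<alpha> \<beta>"
  shows "(derives_step P)\<^sup>*\<^sup>* (u @ \<alpha> @ v) (u @ \<beta> @ v)"
  using assms
  by (induction rule: rtranclp_induct) (auto intro: rtranclp.rtrancl_into_rtrancl derives_step_context)

lemma grammar_language_word:
  assumes "(A, map Inr w) \<in> P"
  shows "w \<in> grammar_language P A"
  using derives_step.intros[OF assms, of "[]" "[]"] by (auto simp: grammar_language_def)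

lemma grammar_language_append:
  assumes "(A, [Inl B, Inl C]) \<in> P" "u \<in> grammar_language P B" "v \<in> grammar_language P C"
  shows "u @ v \<in> grammar_language P A"
proof -
  have "(derives_step P)\<^sup>*\<^sup>* [Inl A] [Inl B, Inl C]"
    using derives_step.intros[OF assms(1), of "[]" "[]"] by auto
  also have "(derives_step P)\<^sup>*\<^sup>* [Inl B, Inl C] (map Inr u @ [Inl C])"
    using derives_context[of P "[Inl B]" "map Inr u" "[]" "[Inl C]"] assms(2)
    by (simp add: grammar_language_def)
  also have "(derives_step P)\<^sup>*\<^sup>* (map Inr u @ [Inl C]) (map Inr (u @ v))"
    using derives_context[of P "[Inl C]" "map Inr v" "map Inr u" "[]"] assms(3)
    by (simp add: grammar_language_def)
  finally show ?thesis
    unfolding grammar_language_def by (rule CollectI)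
qed

text \<open>Binary derivation trees with leaves of length at most one. The condition on
  \<open>x @ y\<close> says that the production from \<open>N\<close> to \<open>L\<close> followed
  by \<open>M\<close> is sound.\<close>

inductive splits :: "'t list set set \<Rightarrow> 't list set \<Rightarrow> 't list \<Rightarrow> bool" for \<L> where
  Nil: "L \<in> \<L> \<Longrightarrow> [] \<in> L \<Longrightarrow> splits \<L> L []"
| letter: "L \<in> \<L> \<Longrightarrow> [s] \<in> L \<Longrightarrow> splits \<L> L [s]"
| append: "splits \<L> L u \<Longrightarrow> splits \<L> M v \<Longrightarrow> N \<in> \<L> \<Longrightarrow> (\<And>x y. x \<in> L \<Longrightarrow> y \<in> M \<Longrightarrow> x @ y \<in> N) \<Longrightarrow>
    splits \<L> N (u @ v)"

lemma splits_family: "splits \<L> L w \<Longrightarrow> L \<in> \<L>"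
  by (induction rule: splits.induct)

text \<open>The members of the family serve as nonterminals; the productions are all those with at
  most two symbols on the right that are sound for this interpretation.\<close>

lemma context_free_languageI:
  fixes \<L> :: "'t list set set"
  assumes "finite \<Sigma>" "finite \<L>" "\<And>L. L \<in> \<L> \<Longrightarrow> L \<subseteq> lists \<Sigma>" "L\<^sub>0 \<in> \<L>"
    and split: "\<And>w. w \<in> L\<^sub>0 \<Longrightarrow> splits \<L> L\<^sub>0 w"
  shows "context_free_language \<Sigma> L\<^sub>0"
proof -
  \<comment> \<open>Grammars take their nonterminals from \<open>nat\<close>, so the finite family
    is numbered.\<close>
  obtain c :: "'t list set \<Rightarrow> nat" where c: "inj_on c \<L>"
    using finite_imp_inj_to_nat_seg[OF \<open>finite \<L>\<close>] by blast
  define I where "I = inv_into \<L> c"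
  have I [simp]: "I (c L) = L" if "L \<in> \<L>" for L
    using c that by (simp add: I_def)
  define V where "V = Inl ` c ` \<L> \<union> Inr ` \<Sigma>"
  define P where "P = {(n, \<alpha>). n \<in> c ` \<L> \<and> set \<alpha> \<subseteq> V \<and> length \<alpha> \<le> 2 \<and> form_language I \<alpha> \<subseteq> I n}"
  have "finite V"
    using assms by (simp add: V_def)
  have "finite (c ` \<L> \<times> {\<alpha>. set \<alpha> \<subseteq> V \<and> length \<alpha> \<le> 2})"
    using assms finite_lists_length_le[OF \<open>finite V\<close>] by blast
  then have "finite P"
    by (rule rev_finite_subset) (auto simp: P_def)
  have terminals: "\<forall>(A, \<alpha>) \<in> P. \<forall>a. Inr a \<in> set \<alpha> \<longrightarrow> a \<in> \<Sigma>"
    unfolding P_def V_def by blast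
  \<comment> \<open>Each rule of \<open>splits\<close> applies one production, and its side
    conditions give exactly the inclusion that \<open>P\<close> demands.\<close>
  have "splits \<L> L w \<Longrightarrow> w \<in> grammar_language P (c L)" for L w
  proof (induction rule: splits.induct)
    case (Nil L)
    then show ?case
      by (intro grammar_language_word) (auto simp: P_def)
  next
    case (letter L s)
    then have "s \<in> \<Sigma>"
      using assms(3) by fastforce
    with letter show ?case
      by (intro grammar_language_word) (auto simp: P_def V_def)
  next
    case (append L u M v N)
    then have "L \<in> \<L>" "M \<in> \<L>"
      by (auto dest: splits_family)
    with append show ?case
      by (intro grammar_language_append[of _ "c L" "c M"]) (auto simp: P_def V_def)
  qed
  then have "L\<^sub>0 \<subseteq> grammar_language P (c L\<^sub>0)"
    using split by blast
  moreover have "grammar_language P (c L\<^sub>0) \<subseteq> I (c L\<^sub>0)"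
    by (rule grammar_language_subset) (auto simp: P_def)
  ultimately have "L\<^sub>0 = grammar_language P (c L\<^sub>0)"
    using \<open>L\<^sub>0 \<in> \<L>\<close> by simp
  with \<open>finite P\<close> terminals \<open>finite \<Sigma>\<close> show ?thesis
    unfolding context_free_language_def by blast
qed


section \<open>Words in groups\<close>

lemma word_map_Nil [simp]: "word_map G \<psi> [] = \<one>\<^bsub>G\<^esub>"
  by (simp add: word_map_def)

lemma word_map_Cons [simp]: "word_map G \<psi> (s # w) = \<psi> s \<otimes>\<^bsub>G\<^esub> word_map G \<psi> w"
  by (simp add: word_map_def)

lemma word_map_carrier_update [simp]: "word_map (G\<lparr>carrier := H\<rparr>) \<psi> w = word_map G \<psi> w"
  by (simp add: word_map_def)

lemma (in monoid) word_map_closed: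
  "\<psi> \<in> A \<rightarrow> carrier G \<Longrightarrow> w \<in> lists A \<Longrightarrow> word_map G \<psi> w \<in> carrier G"
  by (induction w) auto

lemma (in monoid) word_map_append:
  assumes "\<psi> \<in> A \<rightarrow> carrier G" "u \<in> lists A" "v \<in> lists A"
  shows "word_map G \<psi> (u @ v) = word_map G \<psi> u \<otimes> word_map G \<psi> v"
  using assms(2)
proof (induction u)
  case Nil
  show ?case
    using word_map_closed[OF assms(1,3)] by simp
next
  case (Cons s u)
  then show ?case
    using assms word_map_closed[OF assms(1)] m_assoc[of "\<psi> s"] by (auto simp: Pi_iff)
qed

text \<open>Words over an alphabet have no formal inverses, so the inverses of the generators join
  as letters.\<close>

lemma (in group) generate_word_map:
  assumes "S \<subseteq> carrier G" "g \<in> generate G S"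
  shows "\<exists>w \<in> lists (S \<union> m_inv G ` S). word_map G (\<lambda>x. x) w = g"
  using assms(2)
proof (induction rule: generate.induct)
  case one
  show ?case
    by (rule bexI[of _ "[]"]) auto
next
  case (incl h)
  then show ?case
    using assms(1) by (intro bexI[of _ "[h]"]) auto
next
  case (inv h)
  then show ?case
    using assms(1) by (intro bexI[of _ "[inv h]"]) auto
next
  case (eng g h)
  then obtain u v where "u \<in> lists (S \<union> m_inv G ` S)" "v \<in> lists (S \<union> m_inv G ` S)"
    "word_map G (\<lambda>x. x) u = g" "word_map G (\<lambda>x. x) v = h"
    by blast
  moreover have "(\<lambda>x. x) \<in> S \<union> m_inv G ` S \<rightarrow> carrier G"
    using assms(1) by auto
  ultimately show ?case
    using word_map_append by (intro bexI[of _ "u @ v"]) (blast, simp)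
qed

text \<open>Serves twice: for \<open>G\<close> it yields a presentation, for \<open>K\<close> the
  monoid generators to be guessed.\<close>

lemma finitely_generated_word_map:
  assumes "finitely_generated_group G"
  obtains Y where "finite Y" "Y \<subseteq> carrier G" "word_map G (\<lambda>x. x) ` lists Y = carrier G"
proof -
  obtain S where G: "group G" and S: "finite S" "S \<subseteq> carrier G" "generate G S = carrier G"
    using assms unfolding finitely_generated_group_def by blast
  interpret group G by (rule G)
  let ?Y = "S \<union> m_inv G ` S"
  have Y: "?Y \<subseteq> carrier G"
    using S(2) by auto
  have "word_map G (\<lambda>x. x) ` lists ?Y \<subseteq> carrier G"
    using word_map_closed[of "\<lambda>x. x" ?Y] Y by blast
  moreover have "carrier G \<subseteq> word_map G (\<lambda>x. x) ` lists ?Y"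
    using generate_word_map[OF S(2)] S(3) by (metis imageI subsetI)
  ultimately have "word_map G (\<lambda>x. x) ` lists ?Y = carrier G"
    by blast
  then show thesis
    using that[of ?Y] S(1) Y by simp
qed

lemma ex_semigroup_presentation:
  assumes "finitely_generated_group G"
  shows "\<exists>(\<Sigma> :: nat set) \<psi>. semigroup_presentation G \<Sigma> \<psi>"
proof -
  obtain Y where Y: "finite Y" "Y \<subseteq> carrier G" "word_map G (\<lambda>x. x) ` lists Y = carrier G"
    using finitely_generated_word_map[OF assms] by blast
  obtain \<psi> where \<psi>: "bij_betw \<psi> {0..<card Y} Y"
    using ex_bij_betw_nat_finite[OF Y(1)] by blast
  then have img: "\<psi> ` {0..<card Y} = Y"
    by (simp add: bij_betw_def)
  have "word_map G \<psi> w = word_map G (\<lambda>x. x) (map \<psi> w)" for w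
    by (induction w) simp_all
  then have "word_map G \<psi> ` lists {0..<card Y} = word_map G (\<lambda>x. x) ` lists (\<psi> ` {0..<card Y})"
    unfolding lists_image by (simp add: image_image)
  then have "word_map G \<psi> ` lists {0..<card Y} = carrier G"
    by (simp add: img Y(3))
  then have "semigroup_presentation G {0..<card Y} \<psi>"
    unfolding semigroup_presentation_def using Y img by auto
  then show ?thesis
    by blast
qed


section \<open>Reduction in free groups\<close>

lemma not_reduced_wordE:
  assumes "\<not> reduced_word w"
  obtains u x b v where "w = u @ (x, b) # (x, \<not> b) # v"
proof -
  have "\<exists>u x b v. w = u @ (x, b) # (x, \<not> b) # v"
    using assms
  proof (induction w rule: induct_list012)
    case (3 y z w)
    show ?case
    proof (cases "reduced_word (z # w)")
      case True
      with 3 have "fst y = fst z" "snd z = (\<not> snd y)"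
        by (auto simp: reduced_word_def split: prod.splits)
      then have "y # z # w = [] @ (fst y, snd y) # (fst y, \<not> snd y) # w"
        by (simp add: prod_eq_iff)
      then show ?thesis
        by blast
    next
      case False
      then obtain u x b v where "z # w = u @ (x, b) # (x, \<not> b) # v"
        using 3 by blast
      then have "y # z # w = (y # u) @ (x, b) # (x, \<not> b) # v"
        by simp
      then show ?thesis
        by blast
    qed
  qed (simp_all add: reduced_word_def)
  then show thesis
    using that by blast
qed

text \<open>The empty word is reduced and has value one too, so injectivity on reduced words
  applies.\<close>

lemma free_basis_word_one:
  assumes "free_basis G X" "w \<in> lists (X \<times> UNIV)" "word_map G (signed_letter G) w = \<one>\<^bsub>G\<^esub>"
    and "reduced_word w"
  shows "w = []"
proof -
  have "inj_on (word_map G (signed_letter G)) {w \<in> lists (X \<times> UNIV). reduced_word w}"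
    using assms(1) by (simp add: free_basis_def bij_betw_def)
  then show ?thesis
    using assms(2-4) by (auto simp: inj_on_def reduced_word_def)
qed

lemma (in group) signed_letter_closed:
  "X \<subseteq> carrier G \<Longrightarrow> signed_letter G \<in> X \<times> UNIV \<rightarrow> carrier G"
  by (auto simp: signed_letter_def)

lemma (in group) signed_letter_cancel:
  "x \<in> carrier G \<Longrightarrow> signed_letter G (x, b) \<otimes> signed_letter G (x, \<not> b) = \<one>"
  by (simp add: signed_letter_def)


section \<open>Transducers over a group\<close>

text \<open>A path reads a word over \<open>\<Sigma>\<close> while its stage flag is false and silently multiplies by
  elements of \<open>K\<close> once the flag is true. A step from \<open>\<sigma> a \<otimes> h\<close> to \<open>h\<close> outputs the letter \<open>a\<close>. Thus a
  path from \<open>h\<close> to \<open>h'\<close> that multiplies by \<open>g\<close> and outputs a word of value \<open>f\<close> satisfies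
  \<open>h \<otimes> g = f \<otimes> h'\<close>.\<close>

locale transducer = group G for G (structure) +
  fixes \<Sigma> :: "'s set" and \<psi> :: "'s \<Rightarrow> 'a" and K :: "'a set" and H :: "'a set"
    and A :: "'x set" and \<sigma> :: "'x \<Rightarrow> 'a"
  assumes K: "subgroup K G"
    and \<psi>: "\<psi> \<in> \<Sigma> \<rightarrow> carrier G"
    and H: "H \<subseteq> carrier G"
    and \<sigma>: "\<sigma> \<in> A \<rightarrow> carrier G"
begin

text \<open>For \<open>g\<close> in the group: with both flags false, \<open>w\<close> has value
  \<open>g\<close>; from false to true, \<open>g\<close> lies in the left coset of \<open>K\<close>
  at the value of \<open>w\<close>; with both true, \<open>w\<close> is empty and \<open>g\<close>
  is in \<open>K\<close>. Going back from true to false is impossible.\<close>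

definition stage_language :: "bool \<Rightarrow> bool \<Rightarrow> 'a \<Rightarrow> 's list set" where
  "stage_language p q g =
     {w \<in> lists \<Sigma>. (p \<longrightarrow> q \<and> w = []) \<and> inv (word_map G \<psi> w) \<otimes> g \<in> (if q then K else {\<one>})}"

lemma stage_language_append:
  assumes "u \<in> stage_language p q g" "v \<in> stage_language q r h" "g \<in> carrier G" "h \<in> carrier G"
  shows "u @ v \<in> stage_language p r (g \<otimes> h)"
proof -
  have uv: "u \<in> lists \<Sigma>" "v \<in> lists \<Sigma>"
    using assms by (auto simp: stage_language_def)
  let ?u = "word_map G \<psi> u" and ?v = "word_map G \<psi> v"
  have c: "?u \<in> carrier G" "?v \<in> carrier G"
    using word_map_closed[OF \<psi>] uv by auto
  have "inv (word_map G \<psi> (u @ v)) \<otimes> (g \<otimes> h) = inv ?v \<otimes> (inv ?u \<otimes> g) \<otimes> h"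
    using c assms(3,4) by (simp add: word_map_append[OF \<psi> uv] inv_mult_group m_assoc)
  moreover have "inv ?v \<otimes> (inv ?u \<otimes> g) \<otimes> h \<in> (if r then K else {\<one>})"
  \<comment> \<open>If the middle flag is true, \<open>v\<close> is empty and both remaining factors
    lie in \<open>K\<close>. If it is false, the value of \<open>u\<close> cancels \<open>g\<close>,
    leaving the condition on \<open>v\<close>.\<close>
  proof (cases q)
    case True
    with assms have "v = []" "inv ?u \<otimes> g \<in> K" "h \<in> K" r
      by (auto simp: stage_language_def)
    with K assms c show ?thesis
      by (simp add: subgroup.m_closed)
  next
    case False
    with assms have "inv ?u \<otimes> g = \<one>"
      by (auto simp: stage_language_def)
    with assms c show ?thesis
      by (simp add: stage_language_def)
  qed
  moreover have "p \<longrightarrow> r \<and> u @ v = []"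
    using assms by (auto simp: stage_language_def)
  ultimately show ?thesis
    using uv by (simp add: stage_language_def)
qed

text \<open>Indexing by quotients of states, not by pairs of states, makes paths invariant under
  left translation, which the cancellation of outputs relies on.\<close>

definition stage_languages :: "'s list set set" where
  "stage_languages = (\<Union>p. \<Union>q. \<Union>h \<in> H. \<Union>h' \<in> H. {stage_language p q (inv h \<otimes> h')})"

lemma finite_stage_languages: "finite H \<Longrightarrow> finite stage_languages"
  by (auto simp: stage_languages_def)

text \<open>A path without output. It asks for \<open>splits\<close> instead of mere membership, so
  that \<open>w\<close> is derivable within the finite family.\<close>

definition reach :: "bool \<Rightarrow> 'a \<Rightarrow> 's list \<Rightarrow> bool \<Rightarrow> 'a \<Rightarrow> bool" where
  "reach p h w q h' \<longleftrightarrow>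
     h \<in> H \<and> h' \<in> H \<and> splits stage_languages (stage_language p q (inv h \<otimes> h')) w"

lemma reach_short:
  assumes "h \<in> H" "h \<otimes> g \<in> H" "g \<in> carrier G" "w \<in> stage_language p q g" "length w \<le> 1"
  shows "reach p h w q (h \<otimes> g)"
proof -
  have eq: "inv h \<otimes> (h \<otimes> g) = g"
    using assms H by (simp add: m_assoc[symmetric] subset_iff)
  have "stage_language p q (inv h \<otimes> (h \<otimes> g)) \<in> stage_languages"
    unfolding stage_languages_def using assms(1,2) by blast
  then have mem: "stage_language p q g \<in> stage_languages"
    by (simp add: eq)
  have "w = [] \<or> (\<exists>s. w = [s])"
    using assms(5) by (cases w) auto
  then have "splits stage_languages (stage_language p q g) w"
    using mem assms(4) splits.Nil splits.letter by metis
  then show ?thesis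
    using assms(1,2) by (simp add: reach_def eq)
qed

text \<open>With \<open>p\<close> false and \<open>q\<close> true this is the silent switch from
  reading to guessing.\<close>

lemma reach_refl:
  assumes "h \<in> H" "p \<longrightarrow> q"
  shows "reach p h [] q h"
proof -
  have "[] \<in> stage_language p q \<one>"
    using K assms(2) by (simp add: stage_language_def subgroup.one_closed)
  then show ?thesis
    using reach_short[of h \<one> "[]" p q] assms H by (simp add: subset_iff)
qed

lemma reach_trans:
  assumes "reach p h u q h'" "reach q h' v r h''"
  shows "reach p h (u @ v) r h''"
proof -
  have mem: "h \<in> H" "h' \<in> H" "h'' \<in> H"
    using assms by (auto simp: reach_def)
  then have c: "h \<in> carrier G" "h' \<in> carrier G" "h'' \<in> carrier G"
    using H by auto
  \<comment> \<open>Quotients of consecutive states telescope, so concatenating paths is a sound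
    binary production.\<close>
  have eq: "inv h \<otimes> h'' = (inv h \<otimes> h') \<otimes> (inv h' \<otimes> h'')"
    using c by (simp add: m_assoc) (simp add: m_assoc[symmetric])
  have "splits stage_languages (stage_language p r (inv h \<otimes> h'')) (u @ v)"
  proof (rule splits.append)
    show "splits stage_languages (stage_language p q (inv h \<otimes> h')) u"
      "splits stage_languages (stage_language q r (inv h' \<otimes> h'')) v"
      using assms by (simp_all add: reach_def)
    show "stage_language p r (inv h \<otimes> h'') \<in> stage_languages"
      unfolding stage_languages_def using mem by blast
    show "x @ y \<in> stage_language p r (inv h \<otimes> h'')"
      if "x \<in> stage_language p q (inv h \<otimes> h')" "y \<in> stage_language q r (inv h' \<otimes> h'')" for x y
      unfolding eq using that c by (intro stage_language_append) auto
  qed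
  with mem show ?thesis
    by (simp add: reach_def)
qed

lemma reach_translate:
  assumes "reach p h w q h'" "g \<in> carrier G" "g \<otimes> h \<in> H" "g \<otimes> h' \<in> H"
  shows "reach p (g \<otimes> h) w q (g \<otimes> h')"
proof -
  have c: "h \<in> carrier G" "h' \<in> carrier G"
    using assms H by (auto simp: reach_def)
  have "inv g \<otimes> (g \<otimes> h') = h'"
    using c assms(2) by (simp add: m_assoc[symmetric])
  then have "inv (g \<otimes> h) \<otimes> (g \<otimes> h') = inv h \<otimes> h'"
    using c assms(2) by (simp add: inv_mult_group m_assoc)
  then show ?thesis
    using assms by (simp add: reach_def)
qed

text \<open>The list holds the outputs in order; before, between and after them lie output-free
  paths.\<close>

inductive trace :: "'x list \<Rightarrow> bool \<Rightarrow> 'a \<Rightarrow> 's list \<Rightarrow> bool \<Rightarrow> 'a \<Rightarrow> bool" where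
  trace_Nil: "reach p h w q h' \<Longrightarrow> trace [] p h w q h'"
| trace_Cons: "reach p h u q (\<sigma> a \<otimes> h') \<Longrightarrow> a \<in> A \<Longrightarrow> trace os q h' v r h'' \<Longrightarrow>
    trace (a # os) p h (u @ v) r h''"

inductive_cases trace_NilE: "trace [] p h w q h'"
inductive_cases trace_ConsE: "trace (a # os) p h w q h'"

lemma trace_states: "trace os p h w q h' \<Longrightarrow> h \<in> H \<and> h' \<in> H"
  by (induction rule: trace.induct) (auto simp: reach_def)

lemma trace_prepend:
  assumes "trace os q h' v r h''" "reach p h u q h'"
  shows "trace os p h (u @ v) r h''"
  using assms
proof (cases rule: trace.cases)
  case trace_Nil
  then show ?thesis
    using assms(2) by (auto intro: trace.trace_Nil reach_trans)
next
  case (trace_Cons u' q' a h1 os' v')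
  then show ?thesis
    using assms(2) trace.trace_Cons[OF reach_trans[OF assms(2)]] by (metis append.assoc)
qed

lemma trace_append:
  assumes "trace os p h u q h'" "trace os' q h' v r h''"
  shows "trace (os @ os') p h (u @ v) r h''"
  using assms
proof (induction rule: trace.induct)
  case (trace_Nil p h w q h')
  then show ?case
    by (simp add: trace_prepend)
next
  case (trace_Cons p h u q a h' os v r h'')
  then show ?case
    using trace.trace_Cons by (metis append.assoc append_Cons)
qed

text \<open>The path between the two outputs is translated by \<open>\<sigma> a\<close>. It then
  starts where the path before the first output ends, and ends where the path after the second
  output starts, so all three merge.\<close>

lemma trace_cancel:
  assumes "trace (os @ a # b # os') p h w r h'" "\<sigma> a \<otimes> \<sigma> b = \<one>"
  shows "trace (os @ os') p h w r h'"
  using assms(1)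
proof (induction os arbitrary: p h w)
  case Nil
  then obtain u q k v where 1: "w = u @ v" "reach p h u q (\<sigma> a \<otimes> k)" "a \<in> A"
      and "trace (b # os') q k v r h'"
    by (auto elim: trace_ConsE)
  then obtain u' q' k' v' where 2: "v = u' @ v'" "reach q k u' q' (\<sigma> b \<otimes> k')" "b \<in> A"
      and os': "trace os' q' k' v' r h'"
    by (auto elim: trace_ConsE)
  have k': "k' \<in> H"
    using trace_states[OF os'] by simp
  have c: "\<sigma> a \<in> carrier G" "\<sigma> b \<in> carrier G" "k' \<in> carrier G"
    using \<sigma> 1 2 k' H by auto
  have eq: "\<sigma> a \<otimes> (\<sigma> b \<otimes> k') = k'"
    using c assms(2) by (simp add: m_assoc[symmetric])
  \<comment> \<open>Translation may leave \<open>H\<close> in general. Here both new end points are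
    known states: the end of the preceding path and the start \<open>k'\<close> of the remaining
    trace.\<close>
  have "reach q (\<sigma> a \<otimes> k) u' q' (\<sigma> a \<otimes> (\<sigma> b \<otimes> k'))"
    using 1 2 c k' eq by (intro reach_translate) (auto simp: reach_def)
  then have "reach p h (u @ u') q' k'"
    unfolding eq using 1 reach_trans by blast
  then show ?case
    using trace_prepend[OF os'] 1 2 by (metis append.assoc append_Nil)
next
  case (Cons c os)
  then show ?case
    using trace_Cons by (auto elim!: trace_ConsE)
qed

text \<open>Outputs are removed from the left, so the states met are the values of the suffixes of
  \<open>os\<close> times \<open>t\<close>.\<close>

lemma trace_output:
  assumes "os \<in> lists A" "t \<in> H"
    and "\<And>i. i \<le> length os \<Longrightarrow> word_map G \<sigma> (drop i os) \<otimes> t \<in> H"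
  shows "trace os p (word_map G \<sigma> os \<otimes> t) [] p t"
  using assms
proof (induction os rule: list.induct)
  case Nil
  then have "t \<in> carrier G"
    using H by auto
  with Nil show ?case
    by (auto intro: trace_Nil reach_refl)
next
  case (Cons a os)
  have "a \<in> A" "os \<in> lists A"
    using Cons.prems(1) by simp_all
  then have c: "t \<in> carrier G" "\<sigma> a \<in> carrier G" "word_map G \<sigma> os \<in> carrier G"
    using Cons.prems(2) H \<sigma> word_map_closed[OF \<sigma>] by auto
  have "word_map G \<sigma> (drop i os) \<otimes> t \<in> H" if "i \<le> length os" for i
    using Cons.prems(3)[of "Suc i"] that by simp
  then have "trace os p (word_map G \<sigma> os \<otimes> t) [] p t"
    using Cons by simp
  moreover have "reach p (word_map G \<sigma> (a # os) \<otimes> t) [] p (\<sigma> a \<otimes> (word_map G \<sigma> os \<otimes> t))"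
    using Cons.prems(3)[of 0] c reach_refl by (simp add: m_assoc)
  ultimately show ?case
    using trace_Cons[of p _ "[]" p a "word_map G \<sigma> os \<otimes> t" os "[]" p t] Cons.prems(1) by simp
qed

text \<open>Applied once per stage: \<open>\<iota> z\<close> is the input consumed for the factor
  \<open>\<phi> z\<close>, a single letter when reading and the empty word when guessing.\<close>

lemma trace_word:
  assumes step: "\<And>z t. z \<in> Z \<Longrightarrow> t \<in> T \<Longrightarrow> \<exists>os t'. os \<in> lists A \<and> t' \<in> T \<and>
      trace os p t (\<iota> z) p t' \<and> t \<otimes> \<phi> z = word_map G \<sigma> os \<otimes> t'"
    and "T \<subseteq> H" "\<phi> \<in> Z \<rightarrow> carrier G" "zs \<in> lists Z" "t \<in> T"
  shows "\<exists>os t'. os \<in> lists A \<and> t' \<in> T \<and> trace os p t (concat (map \<iota> zs)) p t' \<and>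
    t \<otimes> word_map G \<phi> zs = word_map G \<sigma> os \<otimes> t'"
  using assms(4,5)
proof (induction zs arbitrary: t rule: list.induct)
  case Nil
  then show ?case
    using assms(2) H
    by (intro exI[of _ "[]"] exI[of _ t]) (auto intro: trace_Nil reach_refl)
next
  case (Cons z zs)
  then obtain os t' where 1: "os \<in> lists A" "t' \<in> T" "trace os p t (\<iota> z) p t'"
      "t \<otimes> \<phi> z = word_map G \<sigma> os \<otimes> t'"
    using step by (metis Cons_in_lists_iff)
  obtain os' t'' where 2: "os' \<in> lists A" "t'' \<in> T" "trace os' p t' (concat (map \<iota> zs)) p t''"
      "t' \<otimes> word_map G \<phi> zs = word_map G \<sigma> os' \<otimes> t''"
    using Cons 1(2) by (metis Cons_in_lists_iff)
  have c: "t \<in> carrier G" "t' \<in> carrier G" "t'' \<in> carrier G" "\<phi> z \<in> carrier G"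
      "word_map G \<phi> zs \<in> carrier G" "word_map G \<sigma> os \<in> carrier G" "word_map G \<sigma> os' \<in> carrier G"
    using Cons.prems 1 2 assms(2,3) H word_map_closed[OF \<sigma>] word_map_closed[OF assms(3)]
    by (auto simp: subset_iff)
  have "t \<otimes> word_map G \<phi> (z # zs) = (t \<otimes> \<phi> z) \<otimes> word_map G \<phi> zs"
    using c by (simp add: m_assoc)
  also have "\<dots> = word_map G \<sigma> os \<otimes> (t' \<otimes> word_map G \<phi> zs)"
    unfolding 1(4) using c by (simp add: m_assoc)
  also have "\<dots> = word_map G \<sigma> (os @ os') \<otimes> t''"
    unfolding 2(4) word_map_append[OF \<sigma> 1(1) 2(1)] using c by (simp add: m_assoc)
  finally show ?case
    using 1 2 trace_append
    by (intro exI[of _ "os @ os'"] exI[of _ t'']) auto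
qed

end


section \<open>Virtually free groups\<close>

lemma (in group) finite_transversal:
  assumes "subgroup F G" "finite (rcosets F)"
  obtains T \<tau> where "finite T" "T \<noteq> {}" "T \<subseteq> carrier G" "\<And>g. g \<in> carrier G \<Longrightarrow> \<tau> g \<in> T"
    "\<And>g. g \<in> carrier G \<Longrightarrow> g \<otimes> inv (\<tau> g) \<in> F"
    "\<And>f t t'. f \<in> F \<Longrightarrow> t \<in> T \<Longrightarrow> t' \<in> T \<Longrightarrow> t = f \<otimes> t' \<Longrightarrow> t = t'"
proof -
  define \<rho> where "\<rho> C = (SOME x. x \<in> C)" for C :: "'a set"
  have F: "F \<subseteq> carrier G"
    using assms(1) by (rule subgroup.subset)
  have \<rho>: "\<rho> (F #> g) \<in> F #> g" if "g \<in> carrier G" for g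
    unfolding \<rho>_def using rcos_self[OF that assms(1)] by (rule someI)
  have \<rho>c: "\<rho> (F #> g) \<in> carrier G" if "g \<in> carrier G" for g
    using \<rho>[OF that] r_coset_subset_G[OF F that] by blast
  \<comment> \<open>Chosen elements represent their own cosets, so two of them in the same coset
    coincide.\<close>
  have rep: "t = \<rho> (F #> t)" if t: "t \<in> \<rho> ` (rcosets F)" for t
  proof -
    obtain g where g: "g \<in> carrier G" "t = \<rho> (F #> g)"
      using t by (auto simp: RCOSETS_def)
    then have "F #> g = F #> t"
      using repr_independence[OF \<rho>[OF g(1)] g(1) assms(1)] by simp
    then show ?thesis
      using g by simp
  qed
  show thesis
  proof (rule that[of "\<rho> ` (rcosets F)" "\<lambda>g. \<rho> (F #> g)"])
    show "finite (\<rho> ` (rcosets F))"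
      using assms(2) by simp
    show "\<rho> ` (rcosets F) \<noteq> {}" "\<rho> ` (rcosets F) \<subseteq> carrier G"
      using \<rho>c by (auto simp: RCOSETS_def)
    show "\<rho> (F #> g) \<in> \<rho> ` (rcosets F)" if "g \<in> carrier G" for g
      using that by (auto simp: RCOSETS_def)
    show "g \<otimes> inv (\<rho> (F #> g)) \<in> F" if g: "g \<in> carrier G" for g
    proof -
      obtain f where f: "f \<in> F" "\<rho> (F #> g) = f \<otimes> g"
        using \<rho>[OF g] by (auto simp: r_coset_def)
      then have "g \<otimes> inv (\<rho> (F #> g)) = inv f"
        using F g by (simp add: inv_mult_group m_assoc[symmetric] subset_iff)
      then show ?thesis
        using f(1) assms(1) by (simp add: subgroup.m_inv_closed)
    qed
    show "t = t'" if "f \<in> F" "t \<in> \<rho> ` (rcosets F)" "t' \<in> \<rho> ` (rcosets F)" "t = f \<otimes> t'" for f t t'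
    proof -
      have "t' \<in> carrier G"
        using that(3) \<rho>c by (auto simp: RCOSETS_def)
      moreover from this have "t \<in> F #> t'"
        using that(1,4) by (auto simp: r_coset_def)
      ultimately have "F #> t' = F #> t"
        using repr_independence assms(1) by blast
      then show ?thesis
        using rep that by metis
    qed
  qed
qed

theorem (in group) context_free_pair_language:
  fixes \<Sigma> :: "'s set"
  assumes "virtually_free_group G" "subgroup K G" "finitely_generated_group (G\<lparr>carrier := K\<rparr>)"
    and "finite \<Sigma>" "\<psi> \<in> \<Sigma> \<rightarrow> carrier G"
  shows "context_free_language \<Sigma> (pair_language G K \<Sigma> \<psi>)"
proof -

  \<comment> \<open>Free subgroup, transversal and finite set of states\<close>
  obtain F X where F: "subgroup F G" "finite (rcosets F)" and X: "free_basis (G\<lparr>carrier := F\<rparr>) X"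
    using assms(1) by (auto simp: virtually_free_group_def free_group_def)
  have F_sub: "F \<subseteq> carrier G"
    using F(1) by (rule subgroup.subset)
  interpret F: group "G\<lparr>carrier := F\<rparr>"
    using F(1) by (rule subgroup.subgroup_is_group) (rule is_group)
  define A where "A = X \<times> (UNIV :: bool set)"
  define \<sigma> where "\<sigma> = signed_letter (G\<lparr>carrier := F\<rparr>)"
  have X_sub: "X \<subseteq> F"
    using X by (simp add: free_basis_def)
  have \<sigma>F: "\<sigma> \<in> A \<rightarrow> F"
    using F.signed_letter_closed X_sub by (simp add: \<sigma>_def A_def)
  then have \<sigma>: "\<sigma> \<in> A \<rightarrow> carrier G"
    using F_sub by auto
  have \<sigma>_word: "word_map G \<sigma> os \<in> F" if "os \<in> lists A" for os
    using F.word_map_closed[of \<sigma> A os] \<sigma>F that by simp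
  have ex_word: "\<exists>os \<in> lists A. word_map G \<sigma> os = f" if "f \<in> F" for f
  proof -
    have "word_map G \<sigma> ` {w \<in> lists A. reduced_word w} = F"
      using X by (simp add: free_basis_def bij_betw_def word_map_def A_def \<sigma>_def)
    then show ?thesis
      using that by blast
  qed
  obtain Y where Y: "finite Y" "Y \<subseteq> K" "word_map G (\<lambda>x. x) ` lists Y = K"
    using finitely_generated_word_map[OF assms(3)] by auto
  have K_sub: "K \<subseteq> carrier G"
    using assms(2) by (rule subgroup.subset)
  obtain T \<tau> where T: "finite T" "T \<noteq> {}" "T \<subseteq> carrier G"
    and \<tau>: "\<And>g. g \<in> carrier G \<Longrightarrow> \<tau> g \<in> T" "\<And>g. g \<in> carrier G \<Longrightarrow> g \<otimes> inv (\<tau> g) \<in> F"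
    and T_eq: "\<And>f t t'. f \<in> F \<Longrightarrow> t \<in> T \<Longrightarrow> t' \<in> T \<Longrightarrow> t = f \<otimes> t' \<Longrightarrow> t = t'"
    using finite_transversal[OF F] by blast
  define Z where "Z = \<psi> ` \<Sigma> \<union> Y"
  have Z: "finite Z" "Z \<subseteq> carrier G"
    using assms(4,5) Y K_sub by (auto simp: Z_def)
  \<comment> \<open>\<open>out g\<close> spells the factor in \<open>F\<close> that remains when
    \<open>g\<close> is replaced by its representative \<open>\<tau> g\<close>.\<close>
  have "\<exists>out. \<forall>g \<in> carrier G. out g \<in> lists A \<and> word_map G \<sigma> (out g) = g \<otimes> inv (\<tau> g)"
    using ex_word \<tau>(2) by (intro bchoice) blast
  then obtain out where out: "\<And>g. g \<in> carrier G \<Longrightarrow> out g \<in> lists A"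
      "\<And>g. g \<in> carrier G \<Longrightarrow> word_map G \<sigma> (out g) = g \<otimes> inv (\<tau> g)"
    by blast
  have out_eq: "word_map G \<sigma> (out g) \<otimes> \<tau> g = g" if g: "g \<in> carrier G" for g
  proof -
    have "\<tau> g \<in> carrier G"
      using \<tau>(1)[OF g] T(3) by blast
    then show ?thesis
      using g by (simp add: out(2) m_assoc)
  qed
  \<comment> \<open>Besides \<open>T\<close>, these are the states met while outputting the word for
    \<open>t \<otimes> z\<close>: index 0 gives \<open>t \<otimes> z\<close> itself, the full length
    gives its representative.\<close>
  define H where "H = T \<union> (\<Union>t \<in> T. \<Union>z \<in> Z. \<Union>i \<in> {..length (out (t \<otimes> z))}.
      {word_map G \<sigma> (drop i (out (t \<otimes> z))) \<otimes> \<tau> (t \<otimes> z)})"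
  have "finite H"
    using T(1) Z(1) by (simp add: H_def)
  have TH: "T \<subseteq> H"
    by (simp add: H_def)
  have TZ: "t \<otimes> z \<in> carrier G" if "t \<in> T" "z \<in> Z" for t z
    using T(3) Z(2) that by auto
  have out_H: "word_map G \<sigma> (drop i (out (t \<otimes> z))) \<otimes> \<tau> (t \<otimes> z) \<in> H"
    if "t \<in> T" "z \<in> Z" "i \<le> length (out (t \<otimes> z))" for t z i
    using that unfolding H_def by blast
  have "H \<subseteq> carrier G"
  proof -
    have "word_map G \<sigma> (drop i (out g)) \<otimes> \<tau> g \<in> carrier G" if "g \<in> carrier G" for g i
    proof -
      have "drop i (out g) \<in> lists A"
        using out(1)[OF that] by (auto dest: in_set_dropD)
      then have "word_map G \<sigma> (drop i (out g)) \<in> carrier G"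
        by (rule word_map_closed[OF \<sigma>])
      then show ?thesis
        using \<tau>(1)[OF that] T(3) by blast
    qed
    then show ?thesis
      using T(3) TZ unfolding H_def by blast
  qed
  interpret transducer G \<Sigma> \<psi> K H A \<sigma>
    using assms(2,5) \<open>H \<subseteq> carrier G\<close> \<sigma>
    by (intro transducer.intro transducer_axioms.intro is_group)

  \<comment> \<open>Single moves and removal of outputs\<close>
  have step: "\<exists>os t'. os \<in> lists A \<and> t' \<in> T \<and> trace os p t w p t' \<and> t \<otimes> z = word_map G \<sigma> os \<otimes> t'"
    if tz: "t \<in> T" "z \<in> Z" and w: "w \<in> stage_language p p z" "length w \<le> 1" for t z p w
  proof (intro exI conjI)
    let ?g = "t \<otimes> z"
    have g: "?g \<in> carrier G"
      by (rule TZ[OF tz])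
    show "out ?g \<in> lists A" "\<tau> ?g \<in> T"
      using g out \<tau> by auto
    show "?g = word_map G \<sigma> (out ?g) \<otimes> \<tau> ?g"
      using out_eq[OF g] by simp
    have "trace (out ?g) p (word_map G \<sigma> (out ?g) \<otimes> \<tau> ?g) [] p (\<tau> ?g)"
      using out(1)[OF g] TH \<tau>(1)[OF g] out_H[OF tz] by (intro trace_output) auto
    then have out_trace: "trace (out ?g) p ?g [] p (\<tau> ?g)"
      by (simp add: out_eq[OF g])
    \<comment> \<open>A move first passes from \<open>t\<close> to \<open>t \<otimes> z\<close>
      without output, then outputs its way down to the representative.\<close>
    have "?g \<in> H"
      using trace_states[OF out_trace] by simp
    then have "reach p t w p ?g"
      using tz w TH Z(2) by (intro reach_short) auto
    then show "trace (out ?g) p t w p (\<tau> ?g)"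
      using trace_prepend[OF out_trace] by fastforce
  qed
  \<comment> \<open>A nonempty output of value one is not reduced, so it contains a cancelling pair;
    removing the pair shortens the output.\<close>
  have collapse: "trace [] p h w q h'"
    if "trace os p h w q h'" "os \<in> lists A" "word_map G \<sigma> os = \<one>" for os p h w q h'
    using that
  proof (induction "length os" arbitrary: os rule: less_induct)
    case less
    show ?case
    proof (cases "reduced_word os")
      case True
      then have "os = []"
        using free_basis_word_one[OF X] less.prems by (simp add: A_def \<sigma>_def)
      then show ?thesis
        using less.prems by simp
    next
      case False
      then obtain u x b v where os: "os = u @ (x, b) # (x, \<not> b) # v"
        by (rule not_reduced_wordE)
      then have uv: "u \<in> lists A" "v \<in> lists A" "(x, b) \<in> A" "(x, \<not> b) \<in> A"
        using less.prems(2) by auto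
      then have c: "word_map G \<sigma> u \<in> carrier G" "word_map G \<sigma> v \<in> carrier G"
          "\<sigma> (x, b) \<in> carrier G" "\<sigma> (x, \<not> b) \<in> carrier G"
        using \<sigma> word_map_closed[OF \<sigma>] by auto
      have "x \<in> F"
        using uv X_sub by (auto simp: A_def)
      then have cancel: "\<sigma> (x, b) \<otimes> \<sigma> (x, \<not> b) = \<one>"
        using F.signed_letter_cancel[of x b] by (simp add: \<sigma>_def)
      have "word_map G \<sigma> os = word_map G \<sigma> u \<otimes> ((\<sigma> (x, b) \<otimes> \<sigma> (x, \<not> b)) \<otimes> word_map G \<sigma> v)"
        unfolding os using uv c word_map_append[OF \<sigma>, of u "(x, b) # (x, \<not> b) # v"]
        by (simp add: m_assoc)
      also have "\<dots> = word_map G \<sigma> (u @ v)"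
        using uv c cancel word_map_append[OF \<sigma>] by simp
      finally have "word_map G \<sigma> (u @ v) = \<one>"
        using less.prems by simp
      moreover have "trace (u @ v) p h w q h'"
        using less.prems(1) cancel trace_cancel unfolding os by blast
      ultimately show ?thesis
        using less.hyps[of "u @ v"] uv os by simp
    qed
  qed

  \<comment> \<open>Words of the pair language as closed paths at \<open>t\<close>\<close>
  obtain t where t: "t \<in> T"
    using T(2) by blast
  then have tc: "t \<in> carrier G"
    using T(3) by blast
  have inv_K: "inv g \<in> K \<longleftrightarrow> g \<in> K" if "g \<in> carrier G" for g
    using subgroup.m_inv_closed[OF assms(2)] inv_inv[OF that] by metis
  \<comment> \<open>The quotient is one and \<open>K\<close> is closed under inverses, so the pair
    language itself belongs to the family.\<close>
  have start: "stage_language False True (inv t \<otimes> t) = pair_language G K \<Sigma> \<psi>"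
    unfolding stage_language_def pair_language_def
    using tc word_map_closed[OF assms(5)] inv_K by (intro Collect_cong) (simp cong: conj_cong)
  have "splits stage_languages (stage_language False True (inv t \<otimes> t)) w"
    if w: "w \<in> pair_language G K \<Sigma> \<psi>" for w
  proof -
    have w_lists: "w \<in> lists \<Sigma>" and w_K: "word_map G \<psi> w \<in> K"
      using w by (auto simp: pair_language_def)
    then have "inv (word_map G \<psi> w) \<in> K"
      using assms(2) by (simp add: subgroup.m_inv_closed)
    \<comment> \<open>Guessing \<open>ys\<close> after \<open>w\<close> brings the total value to
      one.\<close>
    then obtain ys where ys: "ys \<in> lists Y" "word_map G (\<lambda>x. x) ys = inv (word_map G \<psi> w)"
      using Y(3) by (metis imageE)
    have letter: "[s] \<in> stage_language False False (\<psi> s)" if "s \<in> \<Sigma>" for s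
      using that assms(5) by (auto simp: stage_language_def Pi_iff)
    have "\<exists>os t'. os \<in> lists A \<and> t' \<in> T \<and> trace os False t (concat (map (\<lambda>s. [s]) w)) False t' \<and>
        t \<otimes> word_map G \<psi> w = word_map G \<sigma> os \<otimes> t'"
      by (rule trace_word[OF _ TH assms(5) w_lists t]) (rule step, auto simp: letter Z_def)
    then obtain os t' where 1: "os \<in> lists A" "t' \<in> T" "trace os False t w False t'"
        "t \<otimes> word_map G \<psi> w = word_map G \<sigma> os \<otimes> t'"
      by auto
    have ghost: "[] \<in> stage_language True True y" if "y \<in> Y" for y
      using that Y(2) K_sub by (simp add: stage_language_def subset_iff)
    have Y_carrier: "(\<lambda>x. x) \<in> Y \<rightarrow> carrier G"
      using Y(2) K_sub by auto
    have "\<exists>os' t''. os' \<in> lists A \<and> t'' \<in> T \<and> trace os' True t' (concat (map (\<lambda>_. []) ys)) True t'' \<and>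
        t' \<otimes> word_map G (\<lambda>x. x) ys = word_map G \<sigma> os' \<otimes> t''"
      by (rule trace_word[OF _ TH Y_carrier ys(1) 1(2)]) (rule step, auto simp: ghost Z_def)
    moreover have "concat (map (\<lambda>_. []) ys) = ([] :: 's list)"
      by (induction ys) simp_all
    ultimately obtain os' t'' where 2: "os' \<in> lists A" "t'' \<in> T" "trace os' True t' [] True t''"
        "t' \<otimes> word_map G (\<lambda>x. x) ys = word_map G \<sigma> os' \<otimes> t''"
      by auto
    \<comment> \<open>The stage switches at \<open>t'\<close>, between the two traces.\<close>
    have "reach False t' [] True t'"
      using 1(2) TH by (intro reach_refl) auto
    then have "trace os' False t' [] True t''"
      using trace_prepend[OF 2(3)] by fastforce
    then have tr: "trace (os @ os') False t w True t''"
      using trace_append[OF 1(3)] by fastforce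
    have c: "word_map G \<psi> w \<in> carrier G" "t' \<in> carrier G" "t'' \<in> carrier G"
        "word_map G \<sigma> os \<in> carrier G" "word_map G \<sigma> os' \<in> carrier G"
      using w_K K_sub 1 2 T(3) word_map_closed[OF \<sigma>] by auto
    have "t = (t \<otimes> word_map G \<psi> w) \<otimes> inv (word_map G \<psi> w)"
      using tc c by (simp add: m_assoc)
    also have "\<dots> = word_map G \<sigma> os \<otimes> (t' \<otimes> word_map G (\<lambda>x. x) ys)"
      unfolding 1(4) ys(2) using c by (simp add: m_assoc)
    also have "\<dots> = word_map G \<sigma> (os @ os') \<otimes> t''"
      unfolding 2(4) word_map_append[OF \<sigma> 1(1) 2(1)] using c by (simp add: m_assoc)
    finally have eq: "t = word_map G \<sigma> (os @ os') \<otimes> t''" .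
    have os_A: "os @ os' \<in> lists A"
      using 1(1) 2(1) by simp
    \<comment> \<open>Start and end lie in the same coset of \<open>F\<close>, hence agree; so the
      whole output has value one and collapses.\<close>
    have t_eq: "t = t''"
      using T_eq[OF \<sigma>_word[OF os_A] t 2(2) eq] .
    have "word_map G \<sigma> (os @ os') = \<one>"
      using eq[folded t_eq] tc word_map_closed[OF \<sigma> os_A] by (simp only: r_cancel_one')
    then have "trace [] False t w True t"
      using collapse[OF tr os_A] t_eq by simp
    then show ?thesis
      by (auto elim: trace_NilE simp: reach_def)
  qed
  moreover have "stage_language False True (inv t \<otimes> t) \<in> stage_languages"
    using t TH unfolding stage_languages_def by blast
  moreover have "L \<subseteq> lists \<Sigma>" if "L \<in> stage_languages" for L
    using that by (auto simp: stage_languages_def stage_language_def)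
  ultimately show ?thesis
    using context_free_languageI[OF assms(4) finite_stage_languages[OF \<open>finite H\<close>]] start by metis
qed

theorem corollary5p6:
  fixes G :: "('a, 'b) monoid_scheme" and K :: "'a set"
  assumes "group G"
    and "finitely_generated_group G"
    and "virtually_free_group G"
    and "subgroup K G"
    and "finitely_generated_group (G\<lparr>carrier := K\<rparr>)"
  shows "context_free_pair G K"
proof -
  obtain \<Sigma> :: "nat set" and \<psi> where \<psi>: "semigroup_presentation G \<Sigma> \<psi>"
    using ex_semigroup_presentation[OF assms(2)] by blast
  then have "context_free_language \<Sigma> (pair_language G K \<Sigma> \<psi>)"
    using group.context_free_pair_language[OF assms(1,3-5)] by (auto simp: semigroup_presentation_def)
  with \<psi> show ?thesis
    unfolding context_free_pair_def by blast
qed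

end
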